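(* There is a universal constant $\gamma\ge1$ such that for all positive integers $m\le N$, all $1\le p\le\frac{2m}{m+1}$, and $r$ with $\frac1r=\frac1p-\frac12$, \[ \frac1{\gamma^m}\Big(\frac Nm\Big)^{\frac mr-\frac12}\le\chi_p\big(\mathcal{B}_N^{=m}\big)\le\chi_p\big(\mathcal{B}_N^{\le m}\big)\le\gamma^m\Big(\frac Nm\Big)^{\frac mr-\frac12}. \]
   Context: $\mathcal{B}_N^{\le m}$ (resp. $\mathcal{B}_N^{=m}$) is the space of functions $f\colon\{-1,1\}^N\to\mathbb{R}$, with sup norm, whose Fourier–Walsh coefficients $\widehat f(S)=2^{-N}\sum_xf(x)\prod_{n\in S}x_n$ ($S\subset\{1,\dots,N\}$) vanish for $|S|>m$ (resp. $|S|\ne m$). The $p$-Sidon constant $\chi_p(V)$ is the best $c$ with $(\sum_S|\widehat f(S)|^p)^{1/p}\le c\|f\|_\infty$ for all $f\in V$. *)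

theory Defs
  imports Complex_Main
begin

definition cube :: "nat \<Rightarrow> (nat \<Rightarrow> real) set" where
  "cube N = {x. (\<forall>n\<in>{1..N}. x n = -1 \<or> x n = 1) \<and> (\<forall>n. n \<notin> {1..N} \<longrightarrow> x n = 1)}"

definition fourier :: "nat \<Rightarrow> ((nat \<Rightarrow> real) \<Rightarrow> real) \<Rightarrow> nat set \<Rightarrow> real" where
  "fourier N f S = (1 / 2 ^ N) * (\<Sum>x\<in>cube N. f x * (\<Prod>n\<in>S. x n))"

definition supnorm :: "nat \<Rightarrow> ((nat \<Rightarrow> real) \<Rightarrow> real) \<Rightarrow> real" where
  "supnorm N f = Max ((\<lambda>x. \<bar>f x\<bar>) ` cube N)"

definition B_le :: "nat \<Rightarrow> nat \<Rightarrow> ((nat \<Rightarrow> real) \<Rightarrow> real) set" where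
  "B_le N m = {f. \<forall>S. S \<subseteq> {1..N} \<and> card S > m \<longrightarrow> fourier N f S = 0}"

definition B_eq :: "nat \<Rightarrow> nat \<Rightarrow> ((nat \<Rightarrow> real) \<Rightarrow> real) set" where
  "B_eq N m = {f. \<forall>S. S \<subseteq> {1..N} \<and> card S \<noteq> m \<longrightarrow> fourier N f S = 0}"

definition sidon :: "nat \<Rightarrow> real \<Rightarrow> ((nat \<Rightarrow> real) \<Rightarrow> real) set \<Rightarrow> real" where
  "sidon N p V = Inf {c. c \<ge> 0 \<and> (\<forall>f\<in>V.
      (\<Sum>S\<in>Pow {1..N}. \<bar>fourier N f S\<bar> powr p) powr (1 / p) \<le> c * supnorm N f)}"

end

theory Submission
  imports Defs "HOL-Computational_Algebra.Polynomial" "HOL-Analysis.Convex"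
begin

text \<open>
  Write \<open>a\<^sub>S\<close> for the Fourier coefficients of \<open>f\<close> of degree at most \<open>m\<close>, and
  \<open>w\<^sub>i\<close> for the \<open>\<ell>\<^sub>2\<close>-norm of those \<open>a\<^sub>S\<close> with \<open>i \<in> S\<close>.

  Upper bound: up to a factor exponential in \<open>m\<close>, Bonami's inequality bounds \<open>w\<^sub>i\<close> by the
  \<open>L\<^sub>1\<close>-norm of the partial derivative \<open>\<partial>\<^sub>i f\<close> at \<open>x/2\<close>, and \<open>\<Sum>\<^sub>i \<bar>\<partial>\<^sub>i f(x/2)\<bar>\<close> is a directional
  derivative of a polynomial of degree \<open>m\<close>, controlled by the sup norm. So \<open>\<Sum>\<^sub>i w\<^sub>i \<le> C\<^sup>m \<parallel>f\<parallel>\<close>.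
  If \<open>\<Sum>\<^sub>i w\<^sub>i \<le> 1\<close> and \<open>k = card S\<close>, the AM-GM inequality for the \<open>k + 1\<close> numbers \<open>a\<^sub>S\<^sup>2 / w\<^sub>i\<close>
  (\<open>i \<in> S\<close>) and \<open>\<Prod>\<^sub>i w\<^sub>i\<close> bounds \<open>\<bar>a\<^sub>S\<bar>\<close> to the power \<open>2k/(k+1)\<close>, and summing over \<open>S\<close> gives the
  Bohnenblust--Hille case \<open>p = 2m/(m+1)\<close>. Smaller \<open>p\<close> follow by comparing norms on the at
  most \<open>(3N/m)\<^sup>m\<close> sets \<open>S\<close> with \<open>card S \<le> m\<close>.

  Lower bound: signs chosen greedily, so that the sum of \<open>cosh (\<lambda> f(x))\<close> over the cube stays small,
  give a homogeneous \<open>f\<close> with coefficients \<open>\<plusminus>1\<close> and sup norm at most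
  \<open>3 sqrt (N (N choose m))\<close>.
\<close>

section \<open>The discrete cube and sums over it\<close>

lemma cube_0: "cube 0 = {\<lambda>_. 1}"
  by (auto simp: cube_def)

lemma cube_value: "x \<in> cube N \<Longrightarrow> x n = -1 \<or> x n = 1"
  unfolding cube_def by (cases "n \<in> {1..N}") auto

lemma cube_value_outside: "x \<in> cube N \<Longrightarrow> n > N \<Longrightarrow> x n = 1"
  unfolding cube_def by auto

text \<open>Points of the cube are normalised to 1 outside \<open>{1..N}\<close>, so
  \<open>cube N\<close> is literally the face of the next cube on which the new coordinate is 1.
  This makes induction on \<open>N\<close> possible without restricting functions.\<close>

lemma cube_Suc: "cube (Suc N) = cube N \<union> (\<lambda>x. x(Suc N := -1)) ` cube N"
proof (intro equalityI subsetI)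
  fix x assume x: "x \<in> cube (Suc N)"
  show "x \<in> cube N \<union> (\<lambda>x. x(Suc N := -1)) ` cube N"
  proof (cases "x (Suc N) = 1")
    case True
    have "x \<in> cube N"
      unfolding cube_def
    proof (intro CollectI conjI ballI allI impI)
      fix n assume "n \<in> {1..N}"
      then show "x n = -1 \<or> x n = 1" using cube_value[OF x] by blast
    next
      fix n assume "n \<notin> {1..N}"
      then show "x n = 1"
        using True x by (cases "n = Suc N") (auto simp: cube_def)
    qed
    then show ?thesis by blast
  next
    case False
    then have "x (Suc N) = -1" using cube_value[OF x] by blast
    then have "x = (x(Suc N := 1))(Suc N := -1)" by auto
    moreover have "x(Suc N := 1) \<in> cube N"
      using x by (auto simp: cube_def)
    ultimately show ?thesis by blast
  qed
next
  fix x assume "x \<in> cube N \<union> (\<lambda>x. x(Suc N := -1)) ` cube N"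
  then show "x \<in> cube (Suc N)"
    by (fastforce simp: cube_def le_Suc_eq)
qed

lemma finite_cube [simp]: "finite (cube N)"
  by (induction N) (auto simp: cube_0 cube_Suc)

lemma one_in_cube: "(\<lambda>_. 1) \<in> cube N"
  by (auto simp: cube_def)

lemma cube_nonempty [simp]: "cube N \<noteq> {}"
  using one_in_cube by blast

lemma sum_cube_Suc:
  fixes g :: "(nat \<Rightarrow> real) \<Rightarrow> 'a::comm_monoid_add"
  shows "(\<Sum>x\<in>cube (Suc N). g x) = (\<Sum>x\<in>cube N. g x + g (x(Suc N := -1)))"
proof -
  have inj: "inj_on (\<lambda>x. x(Suc N := -1)) (cube N)"
  proof (rule inj_onI)
    fix x y :: "nat \<Rightarrow> real"
    assume *: "x \<in> cube N" "y \<in> cube N" "x(Suc N := -1) = y(Suc N := -1)"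
    have "x n = y n" for n
      using fun_cong[OF *(3), of n] cube_value_outside[OF *(1), of "Suc N"]
        cube_value_outside[OF *(2), of "Suc N"] by (cases "n = Suc N") auto
    then show "x = y" by blast
  qed
  have disj: "cube N \<inter> (\<lambda>x. x(Suc N := -1)) ` cube N = {}"
    using cube_value_outside[of _ N "Suc N"] by fastforce
  have "(\<Sum>x\<in>cube (Suc N). g x)
      = (\<Sum>x\<in>cube N. g x) + (\<Sum>x\<in>(\<lambda>x. x(Suc N := -1)) ` cube N. g x)"
    unfolding cube_Suc by (rule sum.union_disjoint) (use disj in auto)
  also have "(\<Sum>x\<in>(\<lambda>x. x(Suc N := -1)) ` cube N. g x) = (\<Sum>x\<in>cube N. g (x(Suc N := -1)))"
    by (simp add: sum.reindex[OF inj])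
  finally show ?thesis by (simp add: sum.distrib)
qed

text \<open>Independence of the coordinates. The cardinality of the cube, the total mass of a
  product density and the orthogonality of characters are all instances of this
  factorisation.\<close>

lemma sum_cube_prod:
  fixes h :: "nat \<Rightarrow> real \<Rightarrow> real"
  shows "(\<Sum>x\<in>cube N. \<Prod>n\<in>{1..N}. h n (x n)) = (\<Prod>n\<in>{1..N}. h n 1 + h n (-1))"
proof (induction N)
  case 0
  then show ?case by (simp add: cube_0)
next
  case (Suc N)
  have "(\<Sum>x\<in>cube (Suc N). \<Prod>n\<in>{1..Suc N}. h n (x n))
      = (\<Sum>x\<in>cube N. (\<Prod>n\<in>{1..N}. h n (x n)) * (h (Suc N) 1 + h (Suc N) (-1)))"
    unfolding sum_cube_Suc
  proof (rule sum.cong)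
    fix x assume x: "x \<in> cube N"
    have "(\<Prod>n\<in>{1..N}. h n ((x(Suc N := -1)) n)) = (\<Prod>n\<in>{1..N}. h n (x n))"
      by (rule prod.cong) auto
    then show "(\<Prod>n\<in>{1..Suc N}. h n (x n)) + (\<Prod>n\<in>{1..Suc N}. h n ((x(Suc N := -1)) n))
        = (\<Prod>n\<in>{1..N}. h n (x n)) * (h (Suc N) 1 + h (Suc N) (-1))"
      using cube_value_outside[OF x, of "Suc N"]
      by (simp add: prod.nat_ivl_Suc' algebra_simps)
  qed simp
  also have "\<dots> = (\<Prod>n\<in>{1..Suc N}. h n 1 + h n (-1))"
    unfolding sum_distrib_right[symmetric] Suc.IH by (simp add: prod.nat_ivl_Suc' mult.commute)
  finally show ?case .
qed

lemma card_cube: "card (cube N) = 2 ^ N"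
  using sum_cube_prod[of "\<lambda>_ _. 1" N] by simp

lemma prod_cube_value:
  assumes "x \<in> cube N"
  shows "(\<Prod>n\<in>S. x n) = -1 \<or> (\<Prod>n\<in>S. x n) = 1"
\<comment> \<open>An infinite \<open>S\<close> yields the default product 1, which fits the
  claim.\<close>
proof (induction S rule: infinite_finite_induct)
  case (insert n S)
  then show ?case using cube_value[OF assms, of n] by auto
qed auto

lemma abs_prod_cube: "x \<in> cube N \<Longrightarrow> \<bar>\<Prod>n\<in>S. x n\<bar> = 1"
  using prod_cube_value[of x N S] by auto

section \<open>Sup norm and multiaffine extension\<close>

lemma abs_le_supnorm: "x \<in> cube N \<Longrightarrow> \<bar>f x\<bar> \<le> supnorm N f"
  unfolding supnorm_def by (rule Max_ge) auto

lemma supnorm_le: "(\<And>x. x \<in> cube N \<Longrightarrow> \<bar>f x\<bar> \<le> B) \<Longrightarrow> supnorm N f \<le> B"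
  unfolding supnorm_def by (subst Max_le_iff) auto

lemma supnorm_nonneg: "supnorm N f \<ge> 0"
  using abs_le_supnorm[OF one_in_cube, of f N] by linarith

lemma abs_fourier_le: "\<bar>fourier N f S\<bar> \<le> supnorm N f"
proof -
  have "\<bar>\<Sum>x\<in>cube N. f x * (\<Prod>n\<in>S. x n)\<bar> \<le> (\<Sum>x\<in>cube N. \<bar>f x * (\<Prod>n\<in>S. x n)\<bar>)"
    by (rule sum_abs)
  also have "\<dots> \<le> (\<Sum>x\<in>cube N. supnorm N f)"
    by (rule sum_mono) (simp add: abs_mult abs_prod_cube abs_le_supnorm)
  also have "\<dots> = 2 ^ N * supnorm N f" by (simp add: card_cube)
  finally show ?thesis by (simp add: fourier_def abs_mult field_simps)
qed

lemma sum_prod_Pow: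
  fixes z :: "'a \<Rightarrow> 'b::comm_semiring_1"
  assumes "finite A"
  shows "(\<Sum>S\<in>Pow A. \<Prod>i\<in>S. z i) = (\<Prod>i\<in>A. 1 + z i)"
  using prod_add[OF assms, of z "\<lambda>_. 1"] by (simp add: add.commute)

text \<open>The multiaffine extension of a function to the solid cube averages its values against the
  product probability density \<open>\<Prod>(1 + x\<^sub>i y\<^sub>i)/2\<close>, hence does not increase the sup norm.\<close>

lemma multiaffine_le_supnorm:
  assumes "\<And>n. n \<in> {1..N} \<Longrightarrow> \<bar>y n\<bar> \<le> 1"
  shows "\<bar>\<Sum>S\<in>Pow {1..N}. fourier N f S * (\<Prod>n\<in>S. y n)\<bar> \<le> supnorm N f"
proof -
  have "(\<Sum>S\<in>Pow {1..N}. fourier N f S * (\<Prod>n\<in>S. y n))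
     = (1 / 2 ^ N) * (\<Sum>S\<in>Pow {1..N}. \<Sum>x\<in>cube N. f x * ((\<Prod>n\<in>S. x n) * (\<Prod>n\<in>S. y n)))"
    unfolding fourier_def sum_distrib_left sum_distrib_right by (simp add: algebra_simps)
  also have "(\<Sum>S\<in>Pow {1..N}. \<Sum>x\<in>cube N. f x * ((\<Prod>n\<in>S. x n) * (\<Prod>n\<in>S. y n)))
     = (\<Sum>x\<in>cube N. f x * (\<Sum>S\<in>Pow {1..N}. \<Prod>n\<in>S. x n * y n))"
    unfolding prod.distrib sum_distrib_left by (rule sum.swap)
  also have "\<dots> = (\<Sum>x\<in>cube N. f x * (\<Prod>n\<in>{1..N}. 1 + x n * y n))"
    by (subst sum_prod_Pow) auto
  finally have eq: "(\<Sum>S\<in>Pow {1..N}. fourier N f S * (\<Prod>n\<in>S. y n))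
     = (1 / 2 ^ N) * (\<Sum>x\<in>cube N. f x * (\<Prod>n\<in>{1..N}. 1 + x n * y n))" .
  have "\<bar>\<Sum>x\<in>cube N. f x * (\<Prod>n\<in>{1..N}. 1 + x n * y n)\<bar>
      \<le> (\<Sum>x\<in>cube N. \<bar>f x * (\<Prod>n\<in>{1..N}. 1 + x n * y n)\<bar>)" by (rule sum_abs)
  also have "\<dots> \<le> (\<Sum>x\<in>cube N. supnorm N f * (\<Prod>n\<in>{1..N}. 1 + x n * y n))"
  proof (rule sum_mono)
    fix x assume x: "x \<in> cube N"
    have "0 \<le> (\<Prod>n\<in>{1..N}. 1 + x n * y n)"
    proof (rule prod_nonneg)
      fix n assume "n \<in> {1..N}"
      then show "0 \<le> 1 + x n * y n" using assms[of n] cube_value[OF x, of n] by auto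
    qed
    then show "\<bar>f x * (\<Prod>n\<in>{1..N}. 1 + x n * y n)\<bar> \<le> supnorm N f * (\<Prod>n\<in>{1..N}. 1 + x n * y n)"
      using abs_le_supnorm[OF x, of f] by (simp add: abs_mult mult_right_mono)
  qed
  also have "\<dots> = supnorm N f * 2 ^ N"
    using sum_cube_prod[of "\<lambda>n t. 1 + t * y n" N] by (simp add: sum_distrib_left[symmetric])
  finally show ?thesis unfolding eq by (simp add: abs_mult field_simps)
qed

section \<open>Walsh characters, Parseval and hypercontractivity\<close>

lemma sum_cube_characters:
  assumes "S \<subseteq> {1..N}" "T \<subseteq> {1..N}"
  shows "(\<Sum>x\<in>cube N. (\<Prod>n\<in>S. x n) * (\<Prod>n\<in>T. x n)) = (if S = T then 2 ^ N else 0)"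
proof -
  \<comment> \<open>Padding with 1 brings both products to the shape of
    \<open>sum_cube_prod\<close>; a coordinate in exactly one of the two sets then contributes the
    factor 1 - 1 = 0.\<close>
  have ext: "(\<Prod>n\<in>S. x n) = (\<Prod>n\<in>{1..N}. if n \<in> S then x n else 1)"
    if "S \<subseteq> {1..N}" for S and x :: "nat \<Rightarrow> real"
    using that by (simp add: prod.If_cases Int_absorb1)
  have "(\<Sum>x\<in>cube N. (\<Prod>n\<in>S. x n) * (\<Prod>n\<in>T. x n))
      = (\<Sum>x\<in>cube N. \<Prod>n\<in>{1..N}. (if n \<in> S then x n else 1) * (if n \<in> T then x n else 1))"
    unfolding ext[OF assms(1)] ext[OF assms(2)] prod.distrib ..
  also have "\<dots> = (\<Prod>n\<in>{1..N}. 1 + (if n \<in> S then -1 else 1) * (if n \<in> T then -1 else 1))"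
    by (subst sum_cube_prod[of "\<lambda>n t. (if n \<in> S then t else 1) * (if n \<in> T then t else 1)"]) simp
  also have "\<dots> = (if S = T then 2 ^ N else 0)"
  proof (cases "S = T")
    case True
    have "(\<Prod>n\<in>{1..N}. 1 + (if n \<in> S then -1 else 1) * (if n \<in> T then -1 else (1::real))) = (\<Prod>n\<in>{1..N}. 2)"
      by (rule prod.cong) (use True in auto)
    then show ?thesis using True by simp
  next
    case False
    then obtain n where n: "n \<in> {1..N}" "(n \<in> S) \<noteq> (n \<in> T)" using assms by blast
    have "(\<Prod>n\<in>{1..N}. 1 + (if n \<in> S then -1 else 1) * (if n \<in> T then -1 else (1::real))) = 0"
      by (rule prod_zero) (use n in auto)
    then show ?thesis using False by simp
  qed
  finally show ?thesis .
qed

text \<open>The coefficients are a free parameter and \<open>x\<close> is unrestricted, so splitting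
  off the last variable gives two sums of the same kind and inductions on \<open>N\<close>
  close.\<close>

definition walsh :: "nat \<Rightarrow> (nat set \<Rightarrow> real) \<Rightarrow> (nat \<Rightarrow> real) \<Rightarrow> real" where
  "walsh N c x = (\<Sum>S\<in>Pow {1..N}. c S * (\<Prod>n\<in>S. x n))"

lemma fourier_walsh:
  assumes "S \<subseteq> {1..N}"
  shows "fourier N (walsh N c) S = c S"
proof -
  have "(\<Sum>x\<in>cube N. walsh N c x * (\<Prod>n\<in>S. x n))
      = (\<Sum>T\<in>Pow {1..N}. c T * (\<Sum>x\<in>cube N. (\<Prod>n\<in>T. x n) * (\<Prod>n\<in>S. x n)))"
    unfolding walsh_def sum_distrib_left sum_distrib_right mult.assoc by (rule sum.swap)
  also have "\<dots> = (\<Sum>T\<in>Pow {1..N}. if T = S then c S * 2 ^ N else 0)"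
    by (rule sum.cong) (use assms in \<open>auto simp: sum_cube_characters\<close>)
  also have "\<dots> = c S * 2 ^ N" using assms by (simp add: sum.delta)
  finally show ?thesis by (simp add: fourier_def)
qed

lemma walsh_0: "walsh 0 c x = c {}"
  by (simp add: walsh_def)

text \<open>Subsets are split by whether they contain \<open>Suc N\<close>. On the cube the new
  variable is 1 or -1, so this becomes the pair g + h, g - h on which Bonami's induction
  runs.\<close>

lemma walsh_Suc:
  "walsh (Suc N) c x = walsh N c x + x (Suc N) * walsh N (\<lambda>S. c (insert (Suc N) S)) x"
proof -
  have eq: "{1..Suc N} = insert (Suc N) {1..N}" by auto
  have inj: "inj_on (insert (Suc N)) (Pow {1..N})"
  proof (rule inj_onI)
    fix S T assume "S \<in> Pow {1..N}" "T \<in> Pow {1..N}" and *: "insert (Suc N) S = insert (Suc N) T"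
    then have "Suc N \<notin> S" "Suc N \<notin> T" by auto
    then show "S = T" using * by (simp add: insert_ident)
  qed
  have "walsh (Suc N) c x = walsh N c x
      + (\<Sum>S\<in>insert (Suc N) ` Pow {1..N}. c S * (\<Prod>n\<in>S. x n))"
    unfolding walsh_def eq Pow_insert by (rule sum.union_disjoint) auto
  also have "(\<Sum>S\<in>insert (Suc N) ` Pow {1..N}. c S * (\<Prod>n\<in>S. x n))
      = (\<Sum>S\<in>Pow {1..N}. c (insert (Suc N) S) * (\<Prod>n\<in>insert (Suc N) S. x n))"
    using sum.reindex[OF inj] by simp
  also have "\<dots> = (\<Sum>S\<in>Pow {1..N}. x (Suc N) * (c (insert (Suc N) S) * (\<Prod>n\<in>S. x n)))"
  proof (rule sum.cong)
    fix S assume "S \<in> Pow {1..N}"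
    then have "Suc N \<notin> S" "finite S" by (auto intro: finite_subset)
    then show "c (insert (Suc N) S) * (\<Prod>n\<in>insert (Suc N) S. x n)
        = x (Suc N) * (c (insert (Suc N) S) * (\<Prod>n\<in>S. x n))" by simp
  qed simp
  finally show ?thesis by (simp add: walsh_def sum_distrib_left)
qed

lemma walsh_update: "walsh N c (x(Suc N := t)) = walsh N c x"
  unfolding walsh_def
proof (intro sum.cong arg_cong2[where f = "(*)"] prod.cong refl)
  fix S n assume "S \<in> Pow {1..N}" "n \<in> S"
  then show "(x(Suc N := t)) n = x n" by auto
qed

lemma sum_cube_Suc_walsh:
  fixes g :: "real \<Rightarrow> real"
  shows "(\<Sum>x\<in>cube (Suc N). g (walsh (Suc N) c x))
    = (\<Sum>x\<in>cube N. g (walsh N c x + walsh N (\<lambda>S. c (insert (Suc N) S)) x)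
                   + g (walsh N c x - walsh N (\<lambda>S. c (insert (Suc N) S)) x))"
  unfolding sum_cube_Suc walsh_Suc
  by (rule sum.cong) (auto simp: walsh_update cube_value_outside)

lemma parseval: "(\<Sum>x\<in>cube N. (walsh N c x)\<^sup>2) = 2 ^ N * (\<Sum>S\<in>Pow {1..N}. (c S)\<^sup>2)"
proof -
  have "(\<Sum>x\<in>cube N. (walsh N c x)\<^sup>2)
      = (\<Sum>x\<in>cube N. \<Sum>S\<in>Pow {1..N}. c S * (walsh N c x * (\<Prod>n\<in>S. x n)))"
    by (simp add: walsh_def power2_eq_square sum_distrib_left algebra_simps)
  also have "\<dots> = (\<Sum>S\<in>Pow {1..N}. c S * (2 ^ N * fourier N (walsh N c) S))"
    unfolding fourier_def by (subst sum.swap) (simp add: sum_distrib_left)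
  also have "\<dots> = (\<Sum>S\<in>Pow {1..N}. 2 ^ N * (c S)\<^sup>2)"
    by (rule sum.cong) (simp_all add: fourier_walsh power2_eq_square)
  finally show ?thesis by (simp add: sum_distrib_left)
qed

text \<open>Bonami's inequality \<open>E g\<^sup>4 \<le> 9\<^sup>d (E g\<^sup>2)\<^sup>2\<close>, with the averages over the cube written as sums.\<close>

lemma bonami:
  assumes "\<And>S. S \<subseteq> {1..N} \<Longrightarrow> card S > d \<Longrightarrow> c S = 0"
  shows "2 ^ N * (\<Sum>x\<in>cube N. (walsh N c x) ^ 4) \<le> 9 ^ d * (\<Sum>x\<in>cube N. (walsh N c x)\<^sup>2)\<^sup>2"
  using assms
proof (induction N arbitrary: c d)
  case 0
  have "(c {}) ^ 4 * 1 \<le> (c {}) ^ 4 * 9 ^ d" by (rule mult_left_mono) auto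
  then show ?case by (simp add: cube_0 walsh_0 mult.commute flip: power_mult)
next
  case (Suc N)
  define c' where "c' = (\<lambda>S. c (insert (Suc N) S))"
  define g h where "g = walsh N c" and "h = walsh N c'"
  define A B where "A = (\<Sum>x\<in>cube N. (g x)\<^sup>2)" and "B = (\<Sum>x\<in>cube N. (h x)\<^sup>2)"
  define P Q R where "P = (\<Sum>x\<in>cube N. (g x) ^ 4)" and "Q = (\<Sum>x\<in>cube N. (g x)\<^sup>2 * (h x)\<^sup>2)"
    and "R = (\<Sum>x\<in>cube N. (h x) ^ 4)"
  have AB: "A \<ge> 0" "B \<ge> 0" unfolding A_def B_def by (auto intro: sum_nonneg)
  have PR: "P \<ge> 0" "R \<ge> 0" "Q \<ge> 0" unfolding P_def R_def Q_def by (auto intro: sum_nonneg)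
  have s4: "(\<Sum>x\<in>cube (Suc N). (walsh (Suc N) c x) ^ 4) = 2 * P + 12 * Q + 2 * R"
  proof -
    have "(a + b) ^ 4 + (a - b) ^ 4 = 2 * a ^ 4 + 12 * (a\<^sup>2 * b\<^sup>2) + 2 * b ^ 4" for a b :: real
      by (simp add: power4_eq_xxxx power2_eq_square algebra_simps)
    then show ?thesis
      unfolding sum_cube_Suc_walsh[of "\<lambda>t. t ^ 4"] P_def Q_def R_def g_def h_def c'_def
      by (simp add: sum.distrib sum_distrib_left)
  qed
  have s2: "(\<Sum>x\<in>cube (Suc N). (walsh (Suc N) c x)\<^sup>2) = 2 * A + 2 * B"
  proof -
    have "(a + b)\<^sup>2 + (a - b)\<^sup>2 = 2 * a\<^sup>2 + 2 * b\<^sup>2" for a b :: real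
      by (simp add: power2_eq_square algebra_simps)
    then show ?thesis
      unfolding sum_cube_Suc_walsh[of "\<lambda>t. t\<^sup>2"] A_def B_def g_def h_def c'_def
      by (simp add: sum.distrib sum_distrib_left)
  qed
  have P: "2 ^ N * P \<le> 9 ^ d * A\<^sup>2"
    unfolding P_def A_def g_def by (rule Suc.IH, rule Suc.prems) auto
  have card: "card (insert (Suc N) S) = Suc (card S)" if "S \<subseteq> {1..N}" for S
    using that by (subst card_insert_disjoint) (auto intro: finite_subset)
  show ?case
  proof (cases d)
    case 0
    have "h x = 0" for x
      unfolding h_def walsh_def c'_def
    proof (rule sum.neutral, rule ballI)
      fix S assume S: "S \<in> Pow {1..N}"
      have "c (insert (Suc N) S) = 0"
        by (rule Suc.prems) (use S card[of S] 0 in auto)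
      then show "c (insert (Suc N) S) * (\<Prod>n\<in>S. x n) = 0" by simp
    qed
    then have "Q = 0" "R = 0" "B = 0" by (simp_all add: Q_def R_def B_def)
    then show ?thesis using P unfolding s4 s2 by (simp add: power2_eq_square)
  next
    case (Suc e)
    \<comment> \<open>\<open>h\<close> has degree at most \<open>e = d - 1\<close>, and the factor 9
      saved here pays for the mixed term: Cauchy-Schwarz bounds \<open>2 ^ N * Q\<close> by
      \<open>3 * 9 ^ e * A * B\<close>, and 24 * 3 * 9^e = 8 * 9^d is exactly the cross coefficient
      of 9^d (2A + 2B)^2.\<close>
    have R: "2 ^ N * R \<le> 9 ^ e * B\<^sup>2"
      unfolding R_def B_def h_def
    proof (rule Suc.IH)
      fix S assume S: "S \<subseteq> {1..N}" "card S > e"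
      show "c' S = 0" unfolding c'_def
        by (rule Suc.prems) (use S card[of S] Suc in auto)
    qed
    have "Q\<^sup>2 \<le> P * R"
      using Cauchy_Schwarz_ineq_sum[of "\<lambda>x. (g x)\<^sup>2" "\<lambda>x. (h x)\<^sup>2" "cube N"]
      unfolding P_def Q_def R_def by (simp flip: power_mult)
    then have "(2 ^ N * Q)\<^sup>2 \<le> (2 ^ N * P) * (2 ^ N * R)"
      by (simp add: power2_eq_square)
    also have "\<dots> \<le> (9 ^ d * A\<^sup>2) * (9 ^ e * B\<^sup>2)"
      by (rule mult_mono) (use P R PR in auto)
    also have "\<dots> = (3 * 9 ^ e * A * B)\<^sup>2"
      by (simp add: Suc power2_eq_square)
    finally have Q: "2 ^ N * Q \<le> 3 * 9 ^ e * A * B"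
      by (rule power2_le_imp_le) (use AB in auto)
    have "2 ^ Suc N * (2 * P + 12 * Q + 2 * R) = 4 * (2 ^ N * P) + 24 * (2 ^ N * Q) + 4 * (2 ^ N * R)"
      by (simp add: algebra_simps)
    also have "\<dots> \<le> 4 * (9 ^ d * A\<^sup>2) + 24 * (3 * 9 ^ e * A * B) + 4 * (9 ^ e * B\<^sup>2)"
      using P Q R by linarith
    also have "\<dots> \<le> 4 * (9 ^ d * A\<^sup>2) + 24 * (3 * 9 ^ e * A * B) + 4 * (9 ^ d * B\<^sup>2)"
      by (simp add: Suc)
    also have "\<dots> = 9 ^ d * (2 * A + 2 * B)\<^sup>2"
      by (simp add: Suc power2_eq_square algebra_simps)
    finally show ?thesis unfolding s4 s2 .
  qed
qed

text \<open>L2 is interpolated between L1 and L4. Two applications of Cauchy-Schwarz give F2^2 \<le>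
  F1 F3 and F3^2 \<le> F2 F4, hence F2^3 \<le> F1^2 F4 when F2 > 0; Bonami's bound on F4 then leaves
  only F1.\<close>

lemma walsh_L2_le_L1:
  assumes "\<And>S. S \<subseteq> {1..N} \<Longrightarrow> card S > d \<Longrightarrow> c S = 0"
  shows "2 ^ N * sqrt (\<Sum>S\<in>Pow {1..N}. (c S)\<^sup>2) \<le> 3 ^ d * (\<Sum>x\<in>cube N. \<bar>walsh N c x\<bar>)"
proof -
  define g where "g = (\<lambda>x. \<bar>walsh N c x\<bar>)"
  define F where "F = (\<lambda>k. \<Sum>x\<in>cube N. g x ^ k)"
  have g: "g x \<ge> 0" for x by (simp add: g_def)
  have F: "F k \<ge> 0" for k unfolding F_def by (rule sum_nonneg) (simp add: g)
  have F2: "F 2 = 2 ^ N * (\<Sum>S\<in>Pow {1..N}. (c S)\<^sup>2)"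
    using parseval[of N c] by (simp add: F_def g_def)
  have F4: "2 ^ N * F 4 \<le> 9 ^ d * (F 2)\<^sup>2"
    using bonami[OF assms, of N] by (simp add: F_def g_def)
  have "(\<Sum>x\<in>cube N. sqrt (g x) * (sqrt (g x) * g x))\<^sup>2
      \<le> (\<Sum>x\<in>cube N. (sqrt (g x))\<^sup>2) * (\<Sum>x\<in>cube N. (sqrt (g x) * g x)\<^sup>2)"
    by (rule Cauchy_Schwarz_ineq_sum)
  moreover have "(\<Sum>x\<in>cube N. sqrt (g x) * (sqrt (g x) * g x)) = F 2"
    unfolding F_def by (rule sum.cong) (use g in \<open>auto simp: power2_eq_square\<close>)
  moreover have "(\<Sum>x\<in>cube N. (sqrt (g x) * g x)\<^sup>2) = F 3"
    unfolding F_def by (rule sum.cong) (use g in \<open>auto simp: power_mult_distrib power3_eq_cube power2_eq_square\<close>)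
  moreover have "(\<Sum>x\<in>cube N. (sqrt (g x))\<^sup>2) = F 1"
    unfolding F_def by (rule sum.cong) (use g in auto)
  ultimately have F13: "(F 2)\<^sup>2 \<le> F 1 * F 3" by simp
  have "(\<Sum>x\<in>cube N. g x * (g x)\<^sup>2)\<^sup>2 \<le> (\<Sum>x\<in>cube N. (g x)\<^sup>2) * (\<Sum>x\<in>cube N. ((g x)\<^sup>2)\<^sup>2)"
    by (rule Cauchy_Schwarz_ineq_sum)
  then have F24: "(F 3)\<^sup>2 \<le> F 2 * F 4"
    by (simp add: F_def power3_eq_cube power2_eq_square power4_eq_xxxx mult.assoc)
  have "2 ^ N * F 2 \<le> (3 ^ d * F 1)\<^sup>2"
  proof (cases "F 2 = 0")
    case False
    then have pos: "F 2 > 0" using F[of 2] by linarith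
    have "((F 2)\<^sup>2)\<^sup>2 \<le> (F 1 * F 3)\<^sup>2" using F13 by (rule power_mono) simp
    also have "\<dots> = (F 1)\<^sup>2 * (F 3)\<^sup>2" by (simp add: power_mult_distrib)
    also have "\<dots> \<le> (F 1)\<^sup>2 * (F 2 * F 4)" using F24 by (rule mult_left_mono) simp
    finally have "2 ^ N * ((F 2)\<^sup>2)\<^sup>2 \<le> ((F 1)\<^sup>2 * F 2) * (2 ^ N * F 4)" by (simp add: mult.commute mult.left_commute)
    also have "\<dots> \<le> ((F 1)\<^sup>2 * F 2) * (9 ^ d * (F 2)\<^sup>2)"
      using F4 by (rule mult_left_mono) (use F in simp)
    finally have "(2 ^ N * F 2) * (F 2) ^ 3 \<le> (9 ^ d * (F 1)\<^sup>2) * (F 2) ^ 3"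
      by (simp add: power2_eq_square power3_eq_cube algebra_simps)
    then have "2 ^ N * F 2 \<le> 9 ^ d * (F 1)\<^sup>2" using pos by simp
    also have "\<dots> = (3 ^ d * F 1)\<^sup>2"
      by (simp add: power_mult_distrib power2_eq_square flip: power_mult_distrib[of "3::real" 3])
    finally show ?thesis .
  qed simp
  moreover have "(2 ^ N * sqrt (\<Sum>S\<in>Pow {1..N}. (c S)\<^sup>2))\<^sup>2 = 2 ^ N * F 2"
    unfolding F2 power_mult_distrib by (simp add: sum_nonneg power2_eq_square[of "2 ^ N"])
  ultimately have "(2 ^ N * sqrt (\<Sum>S\<in>Pow {1..N}. (c S)\<^sup>2))\<^sup>2 \<le> (3 ^ d * F 1)\<^sup>2"
    by simp
  then have "2 ^ N * sqrt (\<Sum>S\<in>Pow {1..N}. (c S)\<^sup>2) \<le> 3 ^ d * F 1"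
    by (rule power2_le_imp_le) (use F in simp)
  then show ?thesis by (simp add: F_def g_def)
qed

section \<open>Finite differences and a Markov inequality\<close>

text \<open>Up to sign the sum is an iterated finite difference at 0; Pascal's rule peels off one
  difference.\<close>

lemma alternating_binomial_sum_Suc:
  fixes g :: "nat \<Rightarrow> 'a::comm_ring_1"
  shows "(\<Sum>k\<le>Suc n. (-1) ^ k * of_nat (Suc n choose k) * g k)
    = (\<Sum>k\<le>n. (-1) ^ k * of_nat (n choose k) * (g k - g (Suc k)))"
proof -
  have "(\<Sum>k\<le>Suc n. (-1) ^ k * of_nat (Suc n choose k) * g k)
     = g 0 + (\<Sum>k\<le>n. (-1) ^ Suc k * of_nat (n choose Suc k) * g (Suc k))
           - (\<Sum>k\<le>n. (-1) ^ k * of_nat (n choose k) * g (Suc k))"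
    by (subst sum.atMost_Suc_shift) (simp add: algebra_simps sum.distrib sum_subtractf sum_negf)
  also have "g 0 + (\<Sum>k\<le>n. (-1) ^ Suc k * of_nat (n choose Suc k) * g (Suc k))
     = (\<Sum>k\<le>Suc n. (-1) ^ k * of_nat (n choose k) * g k)"
    by (subst sum.atMost_Suc_shift) simp
  also have "\<dots> = (\<Sum>k\<le>n. (-1) ^ k * of_nat (n choose k) * g k)" by (simp add: binomial_eq_0)
  finally show ?thesis by (simp add: algebra_simps sum_subtractf)
qed

text \<open>One difference turns the power \<open>j\<close> into a combination of lower powers, so
  \<open>n > j\<close> differences annihilate it.\<close>

lemma alternating_binomial_sum_power:
  assumes "j < n"
  shows "(\<Sum>k\<le>n. (-1) ^ k * of_nat (n choose k) * of_nat k ^ j) = (0 :: 'a::comm_ring_1)"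
  using assms
proof (induction n arbitrary: j)
  case (Suc n)
  have diff: "(of_nat k ^ j - of_nat (Suc k) ^ j :: 'a) = - (\<Sum>i<j. of_nat (j choose i) * of_nat k ^ i)" for k
  proof -
    have "(of_nat (Suc k) ^ j :: 'a) = (\<Sum>i\<le>j. of_nat (j choose i) * of_nat k ^ i)"
      using binomial_ring[of "of_nat k :: 'a" 1 j] by (simp add: add.commute)
    also have "\<dots> = (\<Sum>i<j. of_nat (j choose i) * of_nat k ^ i) + of_nat k ^ j"
      by (simp flip: lessThan_Suc_atMost)
    finally show ?thesis by simp
  qed
  have "(\<Sum>k\<le>Suc n. (-1) ^ k * of_nat (Suc n choose k) * of_nat k ^ j)
      = (\<Sum>k\<le>n. \<Sum>i<j. - (of_nat (j choose i) * ((-1) ^ k * of_nat (n choose k) * of_nat k ^ i)) :: 'a)"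
    unfolding alternating_binomial_sum_Suc diff by (simp add: sum_distrib_left sum_negf algebra_simps)
  also have "\<dots> = (\<Sum>i<j. - (of_nat (j choose i) * (\<Sum>k\<le>n. (-1) ^ k * of_nat (n choose k) * of_nat k ^ i)))"
    by (subst sum.swap) (simp add: sum_distrib_left sum_negf)
  also have "\<dots> = 0"
    by (rule sum.neutral) (use Suc in auto)
  finally show ?case .
qed simp

lemma alternating_binomial_sum_poly:
  fixes P :: "'a::comm_ring_1 poly"
  assumes "degree P < n"
  shows "(\<Sum>k\<le>n. (-1) ^ k * of_nat (n choose k) * poly P (of_nat k * h)) = 0"
proof -
  have "(\<Sum>k\<le>n. (-1) ^ k * of_nat (n choose k) * poly P (of_nat k * h))
      = (\<Sum>k\<le>n. \<Sum>j\<le>degree P. coeff P j * h ^ j * ((-1) ^ k * of_nat (n choose k) * of_nat k ^ j))"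
    by (simp add: poly_altdef sum_distrib_left power_mult_distrib algebra_simps)
  also have "\<dots> = (\<Sum>j\<le>degree P. coeff P j * h ^ j * (\<Sum>k\<le>n. (-1) ^ k * of_nat (n choose k) * of_nat k ^ j))"
    by (subst sum.swap) (simp add: sum_distrib_left)
  also have "\<dots> = 0"
    by (rule sum.neutral) (use assms in \<open>auto simp: alternating_binomial_sum_power\<close>)
  finally show ?thesis .
qed

text \<open>A crude Markov inequality: \<open>s(t) = (q(t) - q(0))/t\<close> has degree below \<open>m\<close>, so the vanishing of its
  \<open>m\<close>-th difference with step \<open>1/m\<close> expresses \<open>s(0) = q'(0)\<close> by values of \<open>s\<close> at \<open>1/m, \<dots>, 1\<close>.\<close>

lemma abs_coeff_1_le:
  fixes q :: "real poly"
  assumes "degree q \<le> m" "m \<ge> 1" and bound: "\<And>t. 0 \<le> t \<Longrightarrow> t \<le> 1 \<Longrightarrow> \<bar>poly q t\<bar> \<le> B"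
  shows "\<bar>coeff q 1\<bar> \<le> 2 * real m * 2 ^ m * B"
proof -
  obtain a s where q: "q = pCons a s" by (cases q)
  have deg: "degree s < m" using assms(1,2) by (auto simp: q degree_pCons_eq_if split: if_splits)
  have B: "B \<ge> 0" using bound[of 0] by auto
  \<comment> \<open>Here \<open>s\<close> is the quotient (q(t) - q(0))/t, and t \<ge> 1/m turns the
    bound 2B on the numerator into 2mB.\<close>
  have s: "\<bar>poly s (real k * (1 / m))\<bar> \<le> 2 * real m * B" if k: "k \<in> {1..m}" for k
  proof -
    define t where "t = real k * (1 / m)"
    have t: "0 < t" "t \<le> 1" "1 \<le> real m * t" using k assms(2) by (auto simp: t_def)
    have "t * poly s t = poly q t - poly q 0" by (simp add: q)
    then have "\<bar>t * poly s t\<bar> \<le> 2 * B"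
      using bound[of t] bound[of 0] t by (simp add: abs_le_iff)
    then have "t * \<bar>poly s t\<bar> \<le> 2 * B" using t by (simp add: abs_mult)
    then have "real m * (t * \<bar>poly s t\<bar>) \<le> real m * (2 * B)" by (rule mult_left_mono) simp
    moreover have "1 * \<bar>poly s t\<bar> \<le> (real m * t) * \<bar>poly s t\<bar>"
      using t by (intro mult_right_mono) auto
    ultimately have "\<bar>poly s t\<bar> \<le> 2 * real m * B" by (simp add: mult.assoc mult.left_commute)
    then show ?thesis by (simp only: t_def)
  qed
  have "0 = (\<Sum>k\<le>m. (-1) ^ k * real (m choose k) * poly s (real k * (1 / m)))"
    by (rule alternating_binomial_sum_poly[OF deg, symmetric])
  also have "\<dots> = poly s 0 + (\<Sum>k\<in>{1..m}. (-1) ^ k * real (m choose k) * poly s (real k * (1 / m)))"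
    by (simp add: atLeast1_atMost_eq_remove0 sum.remove[of "{..m}" 0])
  finally have "\<bar>poly s 0\<bar> = \<bar>\<Sum>k\<in>{1..m}. (-1) ^ k * real (m choose k) * poly s (real k * (1 / m))\<bar>"
    by linarith
  also have "\<dots> \<le> (\<Sum>k\<in>{1..m}. \<bar>(-1) ^ k * real (m choose k) * poly s (real k * (1 / m))\<bar>)"
    by (rule sum_abs)
  also have "\<dots> \<le> (\<Sum>k\<in>{1..m}. real (m choose k) * (2 * real m * B))"
  proof (rule sum_mono)
    fix k assume "k \<in> {1..m}"
    from mult_left_mono[OF s[OF this], of "real (m choose k)"]
    show "\<bar>(-1) ^ k * real (m choose k) * poly s (real k * (1 / m))\<bar> \<le> real (m choose k) * (2 * real m * B)"
      by (simp add: abs_mult power_abs)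
  qed
  also have "\<dots> \<le> (\<Sum>k\<le>m. real (m choose k) * (2 * real m * B))"
    by (rule sum_mono2) (use B in auto)
  also have "\<dots> = real (\<Sum>k\<le>m. m choose k) * (2 * real m * B)"
    by (simp add: sum_distrib_right)
  also have "\<dots> = 2 * real m * 2 ^ m * B" by (simp add: choose_row_sum)
  finally show ?thesis by (simp add: q poly_0_coeff_0)
qed

section \<open>Partial derivatives and the mixed norm\<close>

text \<open>Removing \<open>i\<close> from each set rewrites a partial derivative as a sum over all
  subsets, padded with zeros, which is the form required by \<open>walsh\<close>.\<close>

lemma sum_Pow_mem:
  assumes "finite V" "i \<in> V"
  shows "(\<Sum>S | S \<in> Pow V \<and> i \<in> S. G S) = (\<Sum>S\<in>Pow V. if i \<in> S then 0 else G (insert i S))"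
proof -
  have "(\<Sum>S | S \<in> Pow V \<and> i \<in> S. G S) = (\<Sum>S | S \<in> Pow V \<and> i \<notin> S. G (insert i S))"
    by (rule sum.reindex_bij_witness[where j = "\<lambda>S. S - {i}" and i = "insert i"])
      (use assms in \<open>auto simp: insert_absorb\<close>)
  also have "\<dots> = (\<Sum>S\<in>Pow V. if i \<in> S then 0 else G (insert i S))"
    by (rule sum.mono_neutral_cong_left) (use assms in auto)
  finally show ?thesis .
qed

lemma sum_sum_mem_swap:
  assumes "finite V"
  shows "(\<Sum>S\<in>Pow V. \<Sum>i\<in>S. G i S) = (\<Sum>i\<in>V. \<Sum>S | S \<in> Pow V \<and> i \<in> S. G i S)"
proof -
  have "(\<Sum>S\<in>Pow V. \<Sum>i\<in>S. G i S) = (\<Sum>S\<in>Pow V. \<Sum>i | i \<in> V \<and> i \<in> S. G i S)"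
    by (intro sum.cong) auto
  also have "\<dots> = (\<Sum>i\<in>V. \<Sum>S | S \<in> Pow V \<and> i \<in> S. G i S)"
    by (rule sum.swap_restrict) (use assms in auto)
  finally show ?thesis .
qed

text \<open>The sum of the absolute partial derivatives at \<open>x/2\<close> is the derivative of the multiaffine
  extension in a direction \<open>\<delta>\<close> of signs, along which \<open>x/2 + t\<delta>/2\<close> stays in the solid cube
  for \<open>\<bar>t\<bar> \<le> 1\<close>.\<close>

lemma sum_abs_derivative_le:
  assumes f: "f \<in> B_le N m" and m: "m \<ge> 1" and x: "x \<in> cube N"
  shows "(\<Sum>i\<in>{1..N}. \<bar>\<Sum>S | S \<in> Pow {1..N} \<and> i \<in> S. fourier N f S * (\<Prod>n\<in>S - {i}. x n / 2)\<bar>)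
      \<le> 4 * real m * 2 ^ m * supnorm N f"
proof -
  define a where "a = fourier N f"
  define D where "D = (\<lambda>i. \<Sum>S | S \<in> Pow {1..N} \<and> i \<in> S. a S * (\<Prod>n\<in>S - {i}. x n / 2))"
  define \<delta> where "\<delta> = (\<lambda>i. sgn (D i))"
  \<comment> \<open>This is the multiaffine extension at x/2 + t\<delta>/2, as a polynomial in t.
    Its linear coefficient is half the sum of the \<open>\<bar>D i\<bar>\<close>, which turns the 2
    of \<open>abs_coeff_1_le\<close> into 4.\<close>
  define q where "q = (\<Sum>S\<in>Pow {1..N}. smult (a S) (\<Prod>n\<in>S. [:x n / 2, \<delta> n / 2:]))"
  have a0: "a S = 0" if "S \<subseteq> {1..N}" "card S > m" for S
    using f that by (auto simp: a_def B_le_def)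
  have deg: "degree q \<le> m"
    unfolding q_def
  proof (rule degree_sum_le)
    fix S assume S: "S \<in> Pow {1..N}"
    then have fin: "finite S" by (auto intro: finite_subset)
    show "degree (smult (a S) (\<Prod>n\<in>S. [:x n / 2, \<delta> n / 2:])) \<le> m"
    proof (cases "card S > m")
      case True
      then show ?thesis using a0 S by simp
    next
      case False
      have "degree (\<Prod>n\<in>S. [:x n / 2, \<delta> n / 2:]) \<le> sum (degree \<circ> (\<lambda>n. [:x n / 2, \<delta> n / 2:])) S"
        by (rule degree_prod_sum_le[OF fin])
      also have "\<dots> \<le> sum (\<lambda>_. 1) S" by (rule sum_mono) simp
      also have "\<dots> \<le> m" using False by simp
      finally show ?thesis using degree_smult_le order_trans by blast
    qed
  qed simp
  have "\<bar>poly q t\<bar> \<le> supnorm N f" if t: "0 \<le> t" "t \<le> 1" for t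
  proof -
    have "poly q t = (\<Sum>S\<in>Pow {1..N}. fourier N f S * (\<Prod>n\<in>S. x n / 2 + t * (\<delta> n / 2)))"
      by (simp add: q_def poly_sum poly_prod a_def)
    moreover have "\<bar>x n / 2 + t * (\<delta> n / 2)\<bar> \<le> 1" for n
    proof -
      have "\<bar>t * \<delta> n\<bar> \<le> 1" using t by (auto simp: \<delta>_def sgn_if)
      then show ?thesis using cube_value[OF x, of n] by (auto simp: abs_le_iff)
    qed
    ultimately show ?thesis using multiaffine_le_supnorm[of N] by simp
  qed
  then have c1: "\<bar>coeff q 1\<bar> \<le> 2 * real m * 2 ^ m * supnorm N f"
    using abs_coeff_1_le[OF deg m] by blast
  have "coeff q 1 = (\<Sum>S\<in>Pow {1..N}. a S * coeff (\<Prod>n\<in>S. [:x n / 2, \<delta> n / 2:]) 1)"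
    by (simp add: q_def coeff_sum)
  also have "\<dots> = (\<Sum>S\<in>Pow {1..N}. \<Sum>i\<in>S. \<delta> i / 2 * (a S * (\<Prod>n\<in>S - {i}. x n / 2)))"
  proof (rule sum.cong)
    fix S
    have "coeff (\<Prod>n\<in>S. [:x n / 2, \<delta> n / 2:]) 1 = poly (pderiv (\<Prod>n\<in>S. [:x n / 2, \<delta> n / 2:])) 0"
      by (simp add: poly_0_coeff_0 coeff_pderiv)
    also have "\<dots> = (\<Sum>i\<in>S. (\<Prod>n\<in>S - {i}. x n / 2) * (\<delta> i / 2))"
      by (simp add: pderiv_prod poly_sum poly_prod pderiv_pCons mult.commute)
    finally show "a S * coeff (\<Prod>n\<in>S. [:x n / 2, \<delta> n / 2:]) 1
        = (\<Sum>i\<in>S. \<delta> i / 2 * (a S * (\<Prod>n\<in>S - {i}. x n / 2)))"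
      by (simp add: sum_distrib_left algebra_simps)
  qed simp
  also have "\<dots> = (\<Sum>i\<in>{1..N}. \<delta> i / 2 * D i)"
    by (subst sum_sum_mem_swap) (simp_all add: D_def sum_distrib_left)
  also have "\<dots> = (\<Sum>i\<in>{1..N}. \<bar>D i\<bar>) / 2"
    by (simp add: \<delta>_def sum_divide_distrib abs_sgn mult.commute)
  finally have "(\<Sum>i\<in>{1..N}. \<bar>D i\<bar>) = 2 * coeff q 1" by simp
  then show ?thesis using c1 unfolding D_def a_def by linarith
qed

text \<open>Hypercontractivity is applied to each partial derivative separately. The sum over
  \<open>i\<close> is then moved inside the average over \<open>x\<close>, where
  \<open>sum_abs_derivative_le\<close> controls it pointwise. The base 12 is 3 (Bonami) times 2
  (undoing the dilation x/2) times 2 (finite differences).\<close>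

lemma sum_sqrt_fourier_le:
  assumes f: "f \<in> B_le N m" and m: "m \<ge> 1"
  shows "(\<Sum>i\<in>{1..N}. sqrt (\<Sum>S | S \<in> Pow {1..N} \<and> i \<in> S. (fourier N f S)\<^sup>2))
      \<le> 4 * real m * 12 ^ m * supnorm N f"
proof -
  define a where "a = fourier N f"
  have a0: "a S = 0" if "S \<subseteq> {1..N}" "card S > m" for S
    using f that by (auto simp: a_def B_le_def)
  define D where "D = (\<lambda>i x. \<Sum>S | S \<in> Pow {1..N} \<and> i \<in> S. a S * (\<Prod>n\<in>S - {i}. x n / 2))"
  have single: "2 ^ N * sqrt (\<Sum>S | S \<in> Pow {1..N} \<and> i \<in> S. (a S)\<^sup>2)
      \<le> 6 ^ m * (\<Sum>x\<in>cube N. \<bar>D i x\<bar>)" if i: "i \<in> {1..N}" for i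
  proof -
    \<comment> \<open>The Walsh coefficients of the \<open>i\<close>-th partial derivative at x/2.
      The dilation divides by \<open>2 ^ card S\<close>, a loss of at most \<open>2 ^ m\<close> on
      the sets that matter.\<close>
    define c where "c = (\<lambda>S. if i \<in> S then 0 else a (insert i S) / 2 ^ card S)"
    have walsh: "walsh N c x = D i x" for x
    proof -
      have "D i x = (\<Sum>S\<in>Pow {1..N}. if i \<in> S then 0 else a (insert i S) * (\<Prod>n\<in>insert i S - {i}. x n / 2))"
        unfolding D_def by (rule sum_Pow_mem) (use i in auto)
      also have "\<dots> = walsh N c x"
        unfolding walsh_def c_def by (rule sum.cong) (auto simp: prod_dividef)
      finally show ?thesis by simp
    qed
    have card: "card (insert i S) = Suc (card S)" if "S \<subseteq> {1..N}" "i \<notin> S" for S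
      using that by (subst card_insert_disjoint) (auto intro: finite_subset)
    have L: "2 ^ N * sqrt (\<Sum>S\<in>Pow {1..N}. (c S)\<^sup>2) \<le> 3 ^ m * (\<Sum>x\<in>cube N. \<bar>walsh N c x\<bar>)"
    proof (rule walsh_L2_le_L1)
      fix S assume "S \<subseteq> {1..N}" "card S > m"
      then show "c S = 0" unfolding c_def using i card by (auto intro!: a0)
    qed
    have "sqrt (\<Sum>S | S \<in> Pow {1..N} \<and> i \<in> S. (a S)\<^sup>2) \<le> 2 ^ m * sqrt (\<Sum>S\<in>Pow {1..N}. (c S)\<^sup>2)"
    proof -
      have "(\<Sum>S | S \<in> Pow {1..N} \<and> i \<in> S. (a S)\<^sup>2)
          = (\<Sum>S\<in>Pow {1..N}. if i \<in> S then 0 else (a (insert i S))\<^sup>2)"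
        by (rule sum_Pow_mem) (use i in auto)
      also have "\<dots> \<le> (\<Sum>S\<in>Pow {1..N}. (2 ^ m)\<^sup>2 * (c S)\<^sup>2)"
      proof (rule sum_mono)
        fix S assume S: "S \<in> Pow {1..N}"
        have "(a (insert i S))\<^sup>2 \<le> (2 ^ m)\<^sup>2 * (a (insert i S) / 2 ^ card S)\<^sup>2" if "i \<notin> S"
        proof (cases "card S > m")
          case True
          then show ?thesis using a0[of "insert i S"] card[of S] S i that by auto
        next
          case False
          then have "(2::real) ^ card S \<le> 2 ^ m" by simp
          then have "\<bar>a (insert i S)\<bar> \<le> 2 ^ m * \<bar>a (insert i S) / 2 ^ card S\<bar>"
            by (simp add: field_simps mult_left_mono)
          then have "\<bar>a (insert i S)\<bar>\<^sup>2 \<le> (2 ^ m * \<bar>a (insert i S) / 2 ^ card S\<bar>)\<^sup>2"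
            by (rule power_mono) simp
          then show ?thesis by (simp only: power_mult_distrib power2_abs)
        qed
        then show "(if i \<in> S then 0 else (a (insert i S))\<^sup>2) \<le> (2 ^ m)\<^sup>2 * (c S)\<^sup>2"
          by (simp add: c_def)
      qed
      finally have "sqrt (\<Sum>S | S \<in> Pow {1..N} \<and> i \<in> S. (a S)\<^sup>2)
          \<le> sqrt ((2 ^ m)\<^sup>2 * (\<Sum>S\<in>Pow {1..N}. (c S)\<^sup>2))"
        by (simp add: sum_distrib_left)
      then show ?thesis by (simp add: real_sqrt_mult)
    qed
    then have "2 ^ N * sqrt (\<Sum>S | S \<in> Pow {1..N} \<and> i \<in> S. (a S)\<^sup>2)
        \<le> 2 ^ m * (2 ^ N * sqrt (\<Sum>S\<in>Pow {1..N}. (c S)\<^sup>2))"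
      by (simp add: mult.left_commute)
    also have "\<dots> \<le> 2 ^ m * (3 ^ m * (\<Sum>x\<in>cube N. \<bar>D i x\<bar>))"
      using L walsh by (intro mult_left_mono) auto
    also have "\<dots> = 6 ^ m * (\<Sum>x\<in>cube N. \<bar>D i x\<bar>)"
      by (simp flip: power_mult_distrib mult.assoc)
    finally show ?thesis .
  qed
  have "2 ^ N * (\<Sum>i\<in>{1..N}. sqrt (\<Sum>S | S \<in> Pow {1..N} \<and> i \<in> S. (a S)\<^sup>2))
      \<le> (\<Sum>i\<in>{1..N}. 6 ^ m * (\<Sum>x\<in>cube N. \<bar>D i x\<bar>))"
    unfolding sum_distrib_left[of "2 ^ N"] by (rule sum_mono) (rule single)
  also have "\<dots> = 6 ^ m * (\<Sum>x\<in>cube N. \<Sum>i\<in>{1..N}. \<bar>D i x\<bar>)"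
    unfolding sum_distrib_left[symmetric] by (subst sum.swap) simp
  also have "\<dots> \<le> 6 ^ m * (\<Sum>x\<in>cube N. 4 * real m * 2 ^ m * supnorm N f)"
    unfolding D_def a_def
    by (intro mult_left_mono sum_mono sum_abs_derivative_le f m) auto
  also have "\<dots> = 2 ^ N * (4 * real m * (6 ^ m * 2 ^ m) * supnorm N f)"
    by (simp add: card_cube)
  also have "(6 ^ m * 2 ^ m :: real) = 12 ^ m" by (simp flip: power_mult_distrib)
  finally show ?thesis by (simp add: a_def)
qed

section \<open>The Bohnenblust-Hille inequality and smaller exponents\<close>

text \<open>The k + 1 numbers on the right multiply to a^(2k), so \<open>y\<close> is their
  geometric mean. AM-GM is obtained by summing ln u \<le> u - 1 over these numbers divided by
  \<open>y\<close>, whose logarithms add up to 0.\<close>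

lemma powr_le_sum_plus_prod:
  fixes a :: real
  assumes S: "finite S" and a: "a > 0" and w: "\<And>i. i \<in> S \<Longrightarrow> w i > 0"
  shows "a powr (2 * real (card S) / (real (card S) + 1)) \<le> (\<Sum>i\<in>S. a\<^sup>2 / w i) + (\<Prod>i\<in>S. w i)"
proof -
  define k where "k = real (card S)"
  define y where "y = a powr (2 * k / (k + 1))"
  have k: "k \<ge> 0" by (simp add: k_def)
  have y: "y > 0" using a by (simp add: y_def)
  have "(k + 1) * ln y = 2 * k * ln a"
    using k a by (simp add: y_def ln_powr)
  then have lny: "k * (2 * ln a - ln y) - ln y = 0" by (simp add: algebra_simps)
  have "(\<Sum>i\<in>S. 2 * ln a - ln y - ln (w i)) \<le> (\<Sum>i\<in>S. a\<^sup>2 / w i / y - 1)"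
  proof (rule sum_mono)
    fix i assume i: "i \<in> S"
    have "ln (a\<^sup>2 / w i / y) = 2 * ln a - ln y - ln (w i)"
      using a w[OF i] y by (simp add: ln_div ln_mult ln_realpow)
    then show "2 * ln a - ln y - ln (w i) \<le> a\<^sup>2 / w i / y - 1"
      using ln_le_minus_one[of "a\<^sup>2 / w i / y"] a w[OF i] y by simp
  qed
  moreover have "(\<Sum>i\<in>S. ln (w i)) - ln y \<le> (\<Prod>i\<in>S. w i) / y - 1"
  proof -
    have pos: "(\<Prod>i\<in>S. w i) > 0" using w by (intro prod_pos) auto
    have "ln (\<Prod>i\<in>S. w i) = (\<Sum>i\<in>S. ln (w i))"
      by (rule ln_prod) (use S w in force)+
    then have "ln ((\<Prod>i\<in>S. w i) / y) = (\<Sum>i\<in>S. ln (w i)) - ln y"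
      using pos y by (simp add: ln_div)
    then show ?thesis using ln_le_minus_one[of "(\<Prod>i\<in>S. w i) / y"] pos y by simp
  qed
  ultimately have "k * (2 * ln a - ln y) - ln y \<le> (\<Sum>i\<in>S. a\<^sup>2 / w i / y) - k + ((\<Prod>i\<in>S. w i) / y - 1)"
    by (simp add: sum_subtractf k_def)
  then have "1 \<le> ((\<Sum>i\<in>S. a\<^sup>2 / w i) + (\<Prod>i\<in>S. w i)) / y"
    using lny k by (simp add: add_divide_distrib sum_divide_distrib)
  then show ?thesis using y by (simp add: y_def k_def)
qed

text \<open>With \<open>w\<^sub>i\<close> the \<open>\<ell>\<^sub>2\<close>-norm of the coefficients of sets containing \<open>i\<close>, the AM-GM bound above sums to
  \<open>\<Sum>\<^sub>i w\<^sub>i + \<Prod>\<^sub>i (1 + w\<^sub>i)\<close>. This replaces Blei's mixed-norm interpolation.\<close>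

lemma sum_powr_le_of_mixed_norm:
  fixes c :: "'a set \<Rightarrow> real"
  assumes V: "finite V" and m: "m \<ge> 1"
    and c0: "\<And>S. S \<subseteq> V \<Longrightarrow> card S > m \<Longrightarrow> c S = 0"
    and empty: "\<bar>c {}\<bar> \<le> 1"
    and mixed: "(\<Sum>i\<in>V. sqrt (\<Sum>S | S \<in> Pow V \<and> i \<in> S. (c S)\<^sup>2)) \<le> 1"
  shows "(\<Sum>S\<in>Pow V. \<bar>c S\<bar> powr (2 * real m / (real m + 1))) \<le> 5"
proof -
  define q where "q = 2 * real m / (real m + 1)"
  define w where "w = (\<lambda>i. sqrt (\<Sum>S | S \<in> Pow V \<and> i \<in> S. (c S)\<^sup>2))"
  have w0: "w i \<ge> 0" for i by (simp add: w_def sum_nonneg)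
  have w1: "sum w V \<le> 1" using mixed by (simp add: w_def)
  have cw: "\<bar>c S\<bar> \<le> w i" if "S \<subseteq> V" "i \<in> S" for S i
  proof -
    have "(c S)\<^sup>2 \<le> (\<Sum>S | S \<in> Pow V \<and> i \<in> S. (c S)\<^sup>2)"
      by (rule member_le_sum) (use that V in auto)
    then show ?thesis unfolding w_def using real_sqrt_le_mono by fastforce
  qed
  have "\<bar>c S\<bar> powr q \<le> (\<Sum>i\<in>S. (c S)\<^sup>2 / w i) + (\<Prod>i\<in>S. w i)" if S: "S \<subseteq> V" for S
  proof (cases "c S = 0")
    case True
    then show ?thesis by (simp add: prod_nonneg w0)
  next
    case False
    have fin: "finite S" using S V by (rule finite_subset)
    \<comment> \<open>A base of at most 1 allows the exponent 2k/(k+1), where k = card S \<le> m, to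
      be raised to \<open>q\<close>. The empty set enters no \<open>w i\<close>, hence the
      hypothesis \<open>empty\<close>.\<close>
    have le1: "\<bar>c S\<bar> \<le> 1"
    proof (cases "S = {}")
      case False
      then obtain i where i: "i \<in> S" by blast
      then have "w i \<le> sum w V" by (intro member_le_sum) (use S V w0 in auto)
      then show ?thesis using cw[OF S i] w1 by linarith
    qed (use empty in simp)
    have "card S \<le> m" using False c0[OF S] by force
    then have "2 * real (card S) / (real (card S) + 1) \<le> q"
      by (simp add: q_def field_simps)
    then have "\<bar>c S\<bar> powr q \<le> \<bar>c S\<bar> powr (2 * real (card S) / (real (card S) + 1))"
      using le1 by (intro powr_mono') auto
    also have "\<dots> \<le> (\<Sum>i\<in>S. \<bar>c S\<bar>\<^sup>2 / w i) + (\<Prod>i\<in>S. w i)"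
      by (rule powr_le_sum_plus_prod) (use fin False cw[OF S] in force)+
    finally show ?thesis by simp
  qed
  then have "(\<Sum>S\<in>Pow V. \<bar>c S\<bar> powr q)
      \<le> (\<Sum>S\<in>Pow V. (\<Sum>i\<in>S. (c S)\<^sup>2 / w i) + (\<Prod>i\<in>S. w i))"
    by (intro sum_mono) auto
  also have "\<dots> = (\<Sum>i\<in>V. \<Sum>S | S \<in> Pow V \<and> i \<in> S. (c S)\<^sup>2 / w i) + (\<Prod>i\<in>V. 1 + w i)"
    by (simp add: sum.distrib sum_sum_mem_swap[OF V] sum_prod_Pow[OF V])
  \<comment> \<open>This covers \<open>w i = 0\<close> too, since division by zero gives 0.\<close>
  also have "(\<Sum>i\<in>V. \<Sum>S | S \<in> Pow V \<and> i \<in> S. (c S)\<^sup>2 / w i) = sum w V"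
  proof (rule sum.cong)
    fix i
    have "(\<Sum>S | S \<in> Pow V \<and> i \<in> S. (c S)\<^sup>2) = (w i)\<^sup>2" by (simp add: w_def sum_nonneg)
    then show "(\<Sum>S | S \<in> Pow V \<and> i \<in> S. (c S)\<^sup>2 / w i) = w i"
      by (simp add: power2_eq_square flip: sum_divide_distrib)
  qed simp
  also have "(\<Prod>i\<in>V. 1 + w i) \<le> (\<Prod>i\<in>V. exp (w i))"
    by (rule prod_mono) (use w0 exp_ge_add_one_self in auto)
  also have "(\<Prod>i\<in>V. exp (w i)) = exp (sum w V)" using V by (simp add: exp_sum)
  also have "\<dots> \<le> exp 1" using w1 by simp
  also have "exp 1 \<le> (3::real)" by (rule exp_le)
  finally show ?thesis using w1 by (simp add: q_def)
qed

text \<open>Hoelder's inequality up to a constant: after scaling by \<open>M powr (1 / q)\<close>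
  the elementary bound s^p \<le> 1 + s^q suffices, the 1 being summed over at most \<open>M\<close>
  terms.\<close>

lemma sum_powr_le_of_larger_exponent:
  fixes c :: "'a \<Rightarrow> real"
  assumes p: "1 \<le> p" "p \<le> q" and M: "real (card A) \<le> M" "M \<ge> 1"
    and T: "(\<Sum>x\<in>A. \<bar>c x\<bar> powr q) \<le> T" "T \<ge> 0"
  shows "(\<Sum>x\<in>A. \<bar>c x\<bar> powr p) powr (1 / p) \<le> (1 + T) * M powr (1 / p - 1 / q)"
proof -
  have "\<bar>c x\<bar> powr p \<le> M powr (- (p / q)) * (1 + M * \<bar>c x\<bar> powr q)" for x
  proof -
    define s where "s = \<bar>c x\<bar> * M powr (1 / q)"
    have s: "s \<ge> 0" by (simp add: s_def)
    have "s powr p \<le> 1 + s powr q"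
    proof (cases "s \<le> 1")
      case True
      then have "s powr p \<le> 1" using s p by (intro powr_le1) auto
      then show ?thesis by (simp add: add_increasing2)
    next
      case False
      then have "s powr p \<le> s powr q" using p by (intro powr_mono) auto
      then show ?thesis by simp
    qed
    moreover have "s powr q = M * \<bar>c x\<bar> powr q"
      using p M by (simp add: s_def powr_mult powr_powr)
    moreover have "s powr p = M powr (p / q) * \<bar>c x\<bar> powr p"
      using p M by (simp add: s_def powr_mult powr_powr)
    ultimately have "M powr (p / q) * \<bar>c x\<bar> powr p \<le> 1 + M * \<bar>c x\<bar> powr q" by simp
    then show ?thesis using M by (simp add: powr_minus field_simps)
  qed
  then have "(\<Sum>x\<in>A. \<bar>c x\<bar> powr p) \<le> (\<Sum>x\<in>A. M powr (- (p / q)) * (1 + M * \<bar>c x\<bar> powr q))"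
    by (rule sum_mono)
  also have "\<dots> = M powr (- (p / q)) * (real (card A) + M * (\<Sum>x\<in>A. \<bar>c x\<bar> powr q))"
    by (simp add: sum_distrib_left[symmetric] sum.distrib)
  also have "\<dots> \<le> M powr (- (p / q)) * (M + M * T)"
    using M T by (intro mult_left_mono add_mono) auto
  also have "\<dots> = M powr (1 - p / q) * (1 + T)"
    using M by (simp add: powr_diff powr_minus field_simps)
  finally have "(\<Sum>x\<in>A. \<bar>c x\<bar> powr p) powr (1 / p) \<le> (M powr (1 - p / q) * (1 + T)) powr (1 / p)"
    using p by (intro powr_mono2) (auto intro: sum_nonneg)
  also have "\<dots> = M powr (1 / p - 1 / q) * (1 + T) powr (1 / p)"
    using p T by (simp add: powr_mult powr_powr diff_divide_distrib)
  also have "\<dots> \<le> M powr (1 / p - 1 / q) * (1 + T) powr 1"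
    using p T by (intro mult_left_mono powr_mono) auto
  finally show ?thesis using T by (simp add: mult.commute)
qed

text \<open>Each set is weighted by \<open>t ^ card S\<close>, which is at least
  \<open>t ^ m\<close> on the sets counted. All weights together give (1 + t)^N \<le> exp (t N), and
  t = m/N makes this e^m.\<close>

lemma card_small_subsets_le:
  assumes "1 \<le> m" "m \<le> N"
  shows "real (card {S. S \<subseteq> {1..N} \<and> card S \<le> m}) \<le> (3 * real N / real m) ^ m"
proof -
  define t where "t = real m / real N"
  have t: "0 < t" "t \<le> 1" using assms by (auto simp: t_def)
  have "real (card {S. S \<subseteq> {1..N} \<and> card S \<le> m}) * t ^ m
      = (\<Sum>S\<in>{S. S \<subseteq> {1..N} \<and> card S \<le> m}. t ^ m)" by simp
  also have "\<dots> \<le> (\<Sum>S\<in>{S. S \<subseteq> {1..N} \<and> card S \<le> m}. t ^ card S)"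
    by (rule sum_mono) (use t in \<open>auto intro: power_decreasing\<close>)
  also have "\<dots> \<le> (\<Sum>S\<in>Pow {1..N}. t ^ card S)"
    by (rule sum_mono2) (use t in auto)
  also have "\<dots> = (1 + t) ^ N"
    using sum_prod_Pow[of "{1..N}" "\<lambda>_. t"] by simp
  also have "\<dots> \<le> exp t ^ N"
    using t by (intro power_mono exp_ge_add_one_self) auto
  also have "\<dots> = exp 1 ^ m"
    using assms by (simp add: t_def flip: exp_of_nat_mult)
  also have "\<dots> \<le> 3 ^ m" by (rule power_mono) (use exp_le in auto)
  finally have "real (card {S. S \<subseteq> {1..N} \<and> card S \<le> m}) \<le> 3 ^ m / t ^ m"
    using t by (simp add: field_simps)
  also have "\<dots> = (3 * real N / real m) ^ m"
    using assms by (simp add: t_def power_divide power_mult_distrib)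
  finally show ?thesis .
qed

text \<open>The upper estimate for a single function. The losses multiply to 6 * 4m * 12^m * 3^m =
  24 m 36^m, and 1728 = 24 * 2 * 36 absorbs them through m \<le> 2^m.\<close>

lemma fourier_norm_le:
  assumes m: "1 \<le> m" "m \<le> N" and p: "1 \<le> p" "p \<le> 2 * real m / (real m + 1)"
    and r: "1 / r = 1 / p - 1 / 2" and f: "f \<in> B_le N m"
  shows "(\<Sum>S\<in>Pow {1..N}. \<bar>fourier N f S\<bar> powr p) powr (1 / p)
      \<le> 1728 ^ m * (real N / real m) powr (real m / r - 1 / 2) * supnorm N f"
proof (cases "supnorm N f = 0")
  case True
  then have "fourier N f S = 0" for S using abs_fourier_le[of N f S] by simp
  then show ?thesis using True by simp
next
  case False
  then have pos: "supnorm N f > 0" using supnorm_nonneg[of N f] by linarith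
  define q where "q = 2 * real m / (real m + 1)"
  \<comment> \<open>Division by the bound of \<open>sum_sqrt_fourier_le\<close> normalises the mixed
    norm to at most 1.\<close>
  define L where "L = 4 * real m * 12 ^ m * supnorm N f"
  define c where "c = (\<lambda>S. fourier N f S / L)"
  define A where "A = {S. S \<subseteq> {1..N} \<and> card S \<le> m}"
  define M where "M = (3 * real N / real m) ^ m"
  define e where "e = real m / r - 1 / 2"
  have c0: "c S = 0" if "S \<subseteq> {1..N}" "card S > m" for S
    using f that by (auto simp: c_def B_le_def)
  have L: "L > 0" using pos m by (simp add: L_def)
  have "1 * supnorm N f \<le> (4 * real m * 12 ^ m) * supnorm N f"
  proof (rule mult_right_mono)
    show "1 \<le> 4 * real m * 12 ^ m"
      using mult_mono[of 1 "4 * real m" 1 "12 ^ m"] m by simp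
  qed (use pos in simp)
  then have "supnorm N f \<le> L" by (simp add: L_def)
  then have empty: "\<bar>c {}\<bar> \<le> 1" using abs_fourier_le[of N f "{}"] L by (simp add: c_def)
  have "(\<Sum>i\<in>{1..N}. sqrt (\<Sum>S | S \<in> Pow {1..N} \<and> i \<in> S. (c S)\<^sup>2))
      = (\<Sum>i\<in>{1..N}. sqrt (\<Sum>S | S \<in> Pow {1..N} \<and> i \<in> S. (fourier N f S)\<^sup>2)) / L"
    using L by (simp add: c_def power_divide real_sqrt_divide sum_divide_distrib[symmetric])
  also have "\<dots> \<le> 1"
    using sum_sqrt_fourier_le[OF f m(1)] L by (simp add: L_def)
  finally have "(\<Sum>S\<in>Pow {1..N}. \<bar>c S\<bar> powr q) \<le> 5"
    unfolding q_def by (intro sum_powr_le_of_mixed_norm m(1) c0 empty) auto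
  moreover have "(\<Sum>S\<in>A. \<bar>c S\<bar> powr q) = (\<Sum>S\<in>Pow {1..N}. \<bar>c S\<bar> powr q)"
    by (rule sum.mono_neutral_left) (use c0 in \<open>auto simp: A_def not_le\<close>)
  ultimately have q5: "(\<Sum>S\<in>A. \<bar>c S\<bar> powr q) \<le> 5" by simp
  have "(\<Sum>S\<in>Pow {1..N}. \<bar>fourier N f S\<bar> powr p) = (\<Sum>S\<in>Pow {1..N}. L powr p * \<bar>c S\<bar> powr p)"
    using L by (intro sum.cong) (auto simp: c_def abs_divide powr_divide)
  also have "\<dots> = L powr p * (\<Sum>S\<in>A. \<bar>c S\<bar> powr p)"
    unfolding sum_distrib_left[symmetric]
    by (intro arg_cong2[where f = "(*)"] refl sum.mono_neutral_right) (use c0 in \<open>auto simp: A_def not_le\<close>)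
  finally have "(\<Sum>S\<in>Pow {1..N}. \<bar>fourier N f S\<bar> powr p) powr (1 / p)
      = L * (\<Sum>S\<in>A. \<bar>c S\<bar> powr p) powr (1 / p)"
    using L p by (simp add: powr_mult powr_powr sum_nonneg)
  also have "\<dots> \<le> L * ((1 + 5) * M powr (1 / p - 1 / q))"
  proof (intro mult_left_mono sum_powr_le_of_larger_exponent)
    show "real (card A) \<le> M" unfolding A_def M_def by (rule card_small_subsets_le[OF m])
    show "1 \<le> M" unfolding M_def using m by (intro one_le_power) (auto simp: field_simps)
  qed (use p q5 L in \<open>auto simp: q_def\<close>)
  \<comment> \<open>As 1/2 - 1/q = -1/(2m), raising the base to the power \<open>m\<close> produces
    exactly the exponent m/r - 1/2.\<close>
  also have "M powr (1 / p - 1 / q) = (3 * (real N / real m)) powr e"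
  proof -
    have "real m * (1 / p - 1 / q) = real m * (1 / r) + real m * (1 / 2 - 1 / q)"
      unfolding r by (simp add: algebra_simps)
    also have "\<dots> = e" using m by (simp add: q_def e_def field_simps)
    finally have "e = real m * (1 / p - 1 / q)" by simp
    then show ?thesis using m by (simp add: M_def powr_powr flip: powr_realpow)
  qed
  also have "\<dots> = 3 powr e * (real N / real m) powr e" by (rule powr_mult)
  also have "\<dots> \<le> 3 ^ m * (real N / real m) powr e"
  proof (rule mult_right_mono)
    have "1 / p \<le> 1" using p by simp
    then have "1 / r \<le> 1" using r by linarith
    then have "real m * (1 / r) \<le> real m" using mult_left_mono[of "1 / r" 1 "real m"] by simp
    then have "e \<le> real m" by (simp add: e_def)
    then have "3 powr e \<le> (3::real) powr real m" by (rule powr_mono) simp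
    then show "3 powr e \<le> (3::real) ^ m" by (simp add: powr_realpow)
  qed simp
  finally have "(\<Sum>S\<in>Pow {1..N}. \<bar>fourier N f S\<bar> powr p) powr (1 / p)
      \<le> L * (6 * (3 ^ m * (real N / real m) powr e))" using L by simp
  also have "\<dots> = (24 * real m * 36 ^ m) * ((real N / real m) powr e * supnorm N f)"
  proof -
    have "(36::real) ^ m = 12 ^ m * 3 ^ m" by (simp flip: power_mult_distrib)
    then show ?thesis by (simp add: L_def mult_ac)
  qed
  also have "\<dots> \<le> 1728 ^ m * ((real N / real m) powr e * supnorm N f)"
  proof (rule mult_right_mono)
    have "24 * real m * 36 ^ m \<le> 24 ^ m * 2 ^ m * (36::real) ^ m"
    proof (intro mult_right_mono mult_mono)
      show "(24::real) \<le> 24 ^ m" using power_increasing[of 1 m "24::real"] m by simp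
      show "real m \<le> 2 ^ m" using of_nat_less_two_power[of m, where 'a = real] by simp
    qed auto
    also have "\<dots> = 1728 ^ m" by (simp flip: power_mult_distrib)
    finally show "24 * real m * 36 ^ m \<le> (1728::real) ^ m" .
  qed (use pos in simp)
  finally show ?thesis by (simp add: e_def mult.assoc)
qed

section \<open>Flat homogeneous polynomials and the lower bound\<close>

lemma cosh_le_exp_square: "cosh x \<le> exp (x\<^sup>2)" for x :: real
proof -
  have "cosh y \<le> exp (y\<^sup>2)" if y: "y \<ge> 0" for y :: real
  proof (cases "y \<le> 1")
    case True
    have "exp (-y) * (1 + y) \<le> exp (-y) * exp y"
      by (intro mult_left_mono exp_ge_add_one_self) simp
    also have "\<dots> = 1" by (simp flip: exp_add)
    \<comment> \<open>The product on the right is 1 + y^3.\<close>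
    also have "\<dots> \<le> (1 - y + y\<^sup>2) * (1 + y)"
      using y by (simp add: power2_eq_square algebra_simps)
    finally have "exp (-y) \<le> 1 - y + y\<^sup>2" using y by simp
    moreover have "exp y \<le> 1 + y + y\<^sup>2" using y True by (rule exp_bound)
    ultimately have "cosh y \<le> 1 + y\<^sup>2" by (simp add: cosh_field_def)
    then show ?thesis using exp_ge_add_one_self[of "y\<^sup>2"] by linarith
  next
    case False
    have "exp (-y) \<le> exp y" using y by simp
    then have "cosh y \<le> exp y" by (simp add: cosh_field_def)
    also have "\<dots> \<le> exp (y\<^sup>2)" using False by (simp add: power2_eq_square)
    finally show ?thesis .
  qed
  from this[of "\<bar>x\<bar>"] show ?thesis by simp
qed

text \<open>Signs are fixed one at a time. By cosh (u + v) + cosh (u - v) = 2 cosh u cosh v, the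
  average over the two choices is \<open>cosh l\<close> times the previous sum, so one choice does
  no worse.\<close>

lemma exists_signs_sum_cosh_le:
  fixes w :: "'a \<Rightarrow> 'b \<Rightarrow> real"
  assumes "finite A" and w: "\<And>a x. a \<in> A \<Longrightarrow> x \<in> X \<Longrightarrow> \<bar>w a x\<bar> = 1"
  shows "\<exists>\<epsilon>. (\<forall>a. \<bar>\<epsilon> a\<bar> = 1) \<and>
    (\<Sum>x\<in>X. cosh (l * (\<Sum>a\<in>A. \<epsilon> a * w a x))) \<le> real (card X) * cosh l ^ card A"
  using assms
proof (induction A rule: finite_induct)
  case empty
  show ?case by (rule exI[of _ "\<lambda>_. 1"]) simp
next
  case (insert b A)
  then obtain \<epsilon> where \<epsilon>: "\<And>a. \<bar>\<epsilon> a\<bar> = 1"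
    "(\<Sum>x\<in>X. cosh (l * (\<Sum>a\<in>A. \<epsilon> a * w a x))) \<le> real (card X) * cosh l ^ card A"
    by auto
  define F where "F = (\<lambda>s. \<Sum>x\<in>X. cosh (l * (\<Sum>a\<in>insert b A. (\<epsilon>(b := s)) a * w a x)))"
  have F: "F s = (\<Sum>x\<in>X. cosh (l * (\<Sum>a\<in>A. \<epsilon> a * w a x) + l * (s * w b x)))" for s
  proof -
    have "(\<Sum>a\<in>A. (\<epsilon>(b := s)) a * w a x) = (\<Sum>a\<in>A. \<epsilon> a * w a x)" for x
      by (rule sum.cong) (use insert.hyps in auto)
    then show ?thesis using insert.hyps by (simp add: F_def algebra_simps)
  qed
  have "F 1 + F (-1) = (\<Sum>x\<in>X. 2 * cosh (l * (\<Sum>a\<in>A. \<epsilon> a * w a x)) * cosh l)"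
    unfolding F sum.distrib[symmetric]
  proof (rule sum.cong)
    fix x assume "x \<in> X"
    then have "\<bar>w b x\<bar> = 1" using insert.prems by simp
    then have "cosh (l * w b x) = cosh l" by (auto simp: abs_if split: if_splits)
    then show "cosh (l * (\<Sum>a\<in>A. \<epsilon> a * w a x) + l * (1 * w b x))
        + cosh (l * (\<Sum>a\<in>A. \<epsilon> a * w a x) + l * (-1 * w b x))
        = 2 * cosh (l * (\<Sum>a\<in>A. \<epsilon> a * w a x)) * cosh l"
      by (simp add: cosh_add cosh_diff)
  qed simp
  also have "\<dots> = 2 * ((\<Sum>x\<in>X. cosh (l * (\<Sum>a\<in>A. \<epsilon> a * w a x))) * cosh l)"
    by (simp add: sum_distrib_left sum_distrib_right mult.assoc)
  also have "\<dots> \<le> 2 * (real (card X) * cosh l ^ card A * cosh l)"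
    using \<epsilon>(2) by (intro mult_left_mono mult_right_mono) auto
  also have "\<dots> = 2 * (real (card X) * cosh l ^ card (insert b A))"
    using insert.hyps by (simp add: mult.commute)
  finally have "F 1 \<le> real (card X) * cosh l ^ card (insert b A)
      \<or> F (-1) \<le> real (card X) * cosh l ^ card (insert b A)" by linarith
  then obtain s where "s = 1 \<or> s = -1" "F s \<le> real (card X) * cosh l ^ card (insert b A)"
    by blast
  then show ?case
    using \<epsilon>(1) unfolding F_def by (intro exI[of _ "\<epsilon>(b := s)"]) auto
qed

text \<open>A deterministic form of the Kahane-Salem-Zygmund inequality: a single value of cosh is
  at most the whole sum over the cube.\<close>

lemma exists_signs_supnorm_le:
  assumes "finite A" "A \<noteq> {}" "N \<ge> 1"
  shows "\<exists>\<epsilon>. (\<forall>S. \<bar>\<epsilon> S\<bar> = 1) \<and>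
    supnorm N (\<lambda>x. \<Sum>S\<in>A. \<epsilon> S * (\<Prod>n\<in>S. x n)) \<le> 3 * sqrt (real N * real (card A))"
proof -
  define k where "k = real (card A)"
  \<comment> \<open>Chosen so that l^2 k = N: the cosh factors then cost e^N, comparable to the 2^N
    points, and l \<bar>f x\<bar> \<le> 2N + 1 \<le> 3N.\<close>
  define l where "l = sqrt (real N / k)"
  have k: "k > 0" using assms by (simp add: k_def card_gt_0_iff)
  have l: "l > 0" using k assms by (simp add: l_def)
  have lk: "l\<^sup>2 * k = real N" using k by (simp add: l_def)
  have "\<exists>\<epsilon>. (\<forall>S. \<bar>\<epsilon> S\<bar> = 1) \<and>
    (\<Sum>x\<in>cube N. cosh (l * (\<Sum>S\<in>A. \<epsilon> S * (\<Prod>n\<in>S. x n)))) \<le> real (card (cube N)) * cosh l ^ card A"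
    by (rule exists_signs_sum_cosh_le[OF assms(1)]) (rule abs_prod_cube)
  then obtain \<epsilon> where \<epsilon>: "\<And>S. \<bar>\<epsilon> S\<bar> = 1"
    "(\<Sum>x\<in>cube N. cosh (l * (\<Sum>S\<in>A. \<epsilon> S * (\<Prod>n\<in>S. x n)))) \<le> real (card (cube N)) * cosh l ^ card A"
    by auto
  define f where "f = (\<lambda>x. \<Sum>S\<in>A. \<epsilon> S * (\<Prod>n\<in>S. x n))"
  have "\<bar>f x\<bar> \<le> 3 * sqrt (real N * k)" if x: "x \<in> cube N" for x
  proof -
    have "exp (l * \<bar>f x\<bar>) \<le> 2 * cosh (l * \<bar>f x\<bar>)" by (simp add: cosh_field_def)
    also have "cosh (l * \<bar>f x\<bar>) = cosh (l * f x)"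
      using cosh_real_abs[of "l * f x"] l by (simp add: abs_mult)
    also have "\<dots> \<le> (\<Sum>x\<in>cube N. cosh (l * f x))"
      by (rule member_le_sum) (use x in auto)
    also have "\<dots> \<le> 2 ^ N * cosh l ^ card A" using \<epsilon>(2) by (simp add: f_def card_cube)
    also have "\<dots> \<le> 2 ^ N * exp (l\<^sup>2) ^ card A"
      by (intro mult_left_mono power_mono cosh_le_exp_square) auto
    also have "\<dots> = 2 ^ N * exp (real N)"
      using lk by (simp add: k_def mult.commute flip: exp_of_nat_mult)
    finally have "exp (l * \<bar>f x\<bar>) \<le> 2 ^ Suc N * exp (real N)" by simp
    also have "\<dots> \<le> exp 1 ^ Suc N * exp (real N)"
      by (intro mult_right_mono power_mono) (use exp_ge_add_one_self[of 1] in auto)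
    also have "\<dots> = exp (real (Suc N) + real N)"
      by (simp only: exp_add exp_of_nat_mult[of _ 1, simplified])
    finally have "l * \<bar>f x\<bar> \<le> real (Suc N) + real N" by simp
    also have "\<dots> \<le> 3 * real N" using assms by simp
    also have "\<dots> = l * (3 * (l * k))" using lk by (simp add: power2_eq_square mult_ac)
    finally have "\<bar>f x\<bar> \<le> 3 * (l * k)" using l by simp
    also have "l * k = sqrt (real N * k)"
      using k by (simp add: l_def real_sqrt_divide real_sqrt_mult field_simps)
    finally show ?thesis .
  qed
  then have "supnorm N f \<le> 3 * sqrt (real N * k)" by (rule supnorm_le)
  then show ?thesis using \<epsilon>(1) unfolding f_def k_def by blast
qed

lemma exists_flat_homogeneous:
  assumes "1 \<le> m" "m \<le> N"
  obtains f where "f \<in> B_eq N m"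
    "\<And>p. (\<Sum>S\<in>Pow {1..N}. \<bar>fourier N f S\<bar> powr p) = real (N choose m)"
    "supnorm N f \<le> 3 * sqrt (real N * real (N choose m))"
proof -
  define A where "A = {S. S \<subseteq> {1..N} \<and> card S = m}"
  have card: "card A = N choose m" using n_subsets[of "{1..N}" m] by (simp add: A_def)
  have fin: "finite A" by (simp add: A_def)
  have "card A \<noteq> 0" using assms by (simp add: card)
  then have "A \<noteq> {}" by auto
  then obtain \<epsilon> where \<epsilon>: "\<And>S. \<bar>\<epsilon> S\<bar> = 1"
    "supnorm N (\<lambda>x. \<Sum>S\<in>A. \<epsilon> S * (\<Prod>n\<in>S. x n)) \<le> 3 * sqrt (real N * real (card A))"
    using exists_signs_supnorm_le[OF fin, of N] assms by force
  define c where "c = (\<lambda>S. if card S = m then \<epsilon> S else 0)"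
  have walsh: "walsh N c = (\<lambda>x. \<Sum>S\<in>A. \<epsilon> S * (\<Prod>n\<in>S. x n))"
    unfolding walsh_def A_def c_def by (intro ext sum.mono_neutral_cong_right) auto
  show thesis
  proof
    show "walsh N c \<in> B_eq N m" by (auto simp: B_eq_def fourier_walsh c_def)
    show "supnorm N (walsh N c) \<le> 3 * sqrt (real N * real (N choose m))"
      using \<epsilon>(2) by (simp add: walsh card)
    fix p :: real
    have "(\<Sum>S\<in>Pow {1..N}. \<bar>fourier N (walsh N c) S\<bar> powr p) = (\<Sum>S\<in>A. 1)"
      by (rule sum.mono_neutral_cong_right) (auto simp: A_def fourier_walsh c_def \<epsilon>(1))
    then show "(\<Sum>S\<in>Pow {1..N}. \<bar>fourier N (walsh N c) S\<bar> powr p) = real (N choose m)"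
      by (simp add: card)
  qed
qed

text \<open>Testing on a flat function with k = (N choose m) unit coefficients gives k^(1/p) \<le>
  3c sqrt (N k), that is k^(1/r) \<le> 3c sqrt N, and k \<ge> (N/m)^m. Passing from sqrt N to sqrt
  (N/m) costs sqrt m, absorbed by \<open>6 ^ m\<close>.\<close>

lemma sidon_const_ge:
  assumes m: "1 \<le> m" "m \<le> N" and p: "1 \<le> p" and r: "1 / r = 1 / p - 1 / 2" "1 / r \<ge> 0"
    and c: "c \<ge> 0" "\<And>f. f \<in> B_eq N m \<Longrightarrow>
      (\<Sum>S\<in>Pow {1..N}. \<bar>fourier N f S\<bar> powr p) powr (1 / p) \<le> c * supnorm N f"
  shows "(real N / real m) powr (real m / r - 1 / 2) \<le> 6 ^ m * c"
proof -
  define k where "k = real (N choose m)"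
  have k: "k > 0" using m by (simp add: k_def)
  obtain f where "f \<in> B_eq N m" and norm: "(\<Sum>S\<in>Pow {1..N}. \<bar>fourier N f S\<bar> powr p) = k"
    and sup: "supnorm N f \<le> 3 * sqrt (real N * k)"
    using exists_flat_homogeneous[OF m] unfolding k_def by metis
  then have "k powr (1 / p) \<le> c * supnorm N f" using c(2) by metis
  also have "\<dots> \<le> c * (3 * sqrt (real N * k))" using sup c(1) by (rule mult_left_mono)
  also have "\<dots> = 3 * c * sqrt (real N) * k powr (1 / 2)" using k by (simp add: real_sqrt_mult powr_half_sqrt)
  finally have "k powr (1 / r) * k powr (1 / 2) \<le> 3 * c * sqrt (real N) * k powr (1 / 2)"
    unfolding r(1) by (simp flip: powr_add)
  then have kr: "k powr (1 / r) \<le> 3 * c * sqrt (real N)" using k by simp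
  have N: "real N / real m > 0" using m by simp
  have "(real N / real m) powr (real m / r) = ((real N / real m) ^ m) powr (1 / r)"
    using N by (simp add: powr_powr flip: powr_realpow)
  also have "\<dots> \<le> k powr (1 / r)"
    unfolding k_def using m r(2) by (intro powr_mono2 binomial_ge_n_over_k_pow_k) auto
  finally have "(real N / real m) powr (real m / r) \<le> 3 * c * sqrt (real N)" using kr by linarith
  then have "(real N / real m) powr (real m / r - 1 / 2) \<le> 3 * c * sqrt (real N) / sqrt (real N / real m)"
    using N by (simp add: powr_diff powr_half_sqrt divide_right_mono)
  also have "\<dots> = 3 * sqrt (real m) * c" using m by (simp add: real_sqrt_divide)
  also have "\<dots> \<le> 6 ^ m * c"
  proof (intro mult_right_mono c(1))
    have "sqrt (real m) \<le> real m" using m by (intro real_le_lsqrt) (auto simp: power2_eq_square)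
    also have "\<dots> \<le> 2 ^ m" using of_nat_less_two_power[of m, where 'a = real] by simp
    finally have "3 * sqrt (real m) \<le> 3 ^ m * 2 ^ m"
      using power_increasing[of 1 m "3::real"] m by (intro mult_mono) auto
    then show "3 * sqrt (real m) \<le> 6 ^ m" by (simp flip: power_mult_distrib)
  qed
  finally show ?thesis .
qed

section \<open>Sidon constants and the two-sided estimate\<close>

lemma sidon_le:
  assumes "c \<ge> 0" "\<And>f. f \<in> V \<Longrightarrow>
    (\<Sum>S\<in>Pow {1..N}. \<bar>fourier N f S\<bar> powr p) powr (1 / p) \<le> c * supnorm N f"
  shows "sidon N p V \<le> c"
  unfolding sidon_def by (rule cInf_lower) (use assms in \<open>auto intro!: bdd_belowI[of _ 0]\<close>)

text \<open>Some admissible constant \<open>c0\<close> must be supplied, as the infimum of the empty set is unspecified.\<close>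

lemma le_sidon:
  assumes "c0 \<ge> 0" "\<And>f. f \<in> V \<Longrightarrow>
      (\<Sum>S\<in>Pow {1..N}. \<bar>fourier N f S\<bar> powr p) powr (1 / p) \<le> c0 * supnorm N f"
    and "\<And>c. c \<ge> 0 \<Longrightarrow> (\<And>f. f \<in> V \<Longrightarrow>
      (\<Sum>S\<in>Pow {1..N}. \<bar>fourier N f S\<bar> powr p) powr (1 / p) \<le> c * supnorm N f) \<Longrightarrow> b \<le> c"
  shows "b \<le> sidon N p V"
  unfolding sidon_def by (rule cInf_greatest) (use assms in auto)

lemma B_eq_subset_B_le: "B_eq N m \<subseteq> B_le N m"
  by (auto simp: B_eq_def B_le_def)

theorem theorem6p8:
  shows "\<exists>\<gamma>::real. \<gamma> \<ge> 1 \<and>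
    (\<forall>(N::nat) (m::nat) (p::real) (r::real).
       1 \<le> m \<longrightarrow> m \<le> N \<longrightarrow> 1 \<le> p \<longrightarrow> p \<le> 2 * real m / (real m + 1) \<longrightarrow>
       1 / r = 1 / p - 1 / 2 \<longrightarrow>
         (1 / \<gamma> ^ m) * (real N / real m) powr (real m / r - 1 / 2) \<le> sidon N p (B_eq N m)
       \<and> sidon N p (B_eq N m) \<le> sidon N p (B_le N m)
       \<and> sidon N p (B_le N m) \<le> \<gamma> ^ m * (real N / real m) powr (real m / r - 1 / 2))"
proof (intro exI[of _ 1728] conjI allI impI)
  fix N m :: nat and p r :: real
  assume m: "1 \<le> m" "m \<le> N" and p: "1 \<le> p" "p \<le> 2 * real m / (real m + 1)"
    and r: "1 / r = 1 / p - 1 / 2"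
  define E where "E = (real N / real m) powr (real m / r - 1 / 2)"
  have E: "E \<ge> 0" by (simp add: E_def)
  have upper: "(\<Sum>S\<in>Pow {1..N}. \<bar>fourier N f S\<bar> powr p) powr (1 / p) \<le> (1728 ^ m * E) * supnorm N f"
    if "f \<in> B_le N m" for f
    unfolding E_def using m p r that by (rule fourier_norm_le)
  have pos: "1728 ^ m * E \<ge> 0" using E by simp
  show "sidon N p (B_le N m) \<le> 1728 ^ m * (real N / real m) powr (real m / r - 1 / 2)"
    unfolding E_def[symmetric] by (rule sidon_le[OF pos upper])
  show "sidon N p (B_eq N m) \<le> sidon N p (B_le N m)"
    \<comment> \<open>A constant admissible for the larger space is admissible for the smaller one;
      \<open>upper\<close> certifies that one exists.\<close>
    by (rule le_sidon[OF pos upper], assumption, rule sidon_le) (use B_eq_subset_B_le in auto)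
  show "1 / 1728 ^ m * (real N / real m) powr (real m / r - 1 / 2) \<le> sidon N p (B_eq N m)"
    unfolding E_def[symmetric]
  proof (rule le_sidon[OF pos upper])
    fix f assume "f \<in> B_eq N m"
    then show "f \<in> B_le N m" using B_eq_subset_B_le by blast
  next
    fix c assume c: "c \<ge> 0" "\<And>f. f \<in> B_eq N m \<Longrightarrow>
      (\<Sum>S\<in>Pow {1..N}. \<bar>fourier N f S\<bar> powr p) powr (1 / p) \<le> c * supnorm N f"
    have "2 * real m / (real m + 1) \<le> 2" by (simp add: field_simps)
    then have "p \<le> 2" using p(2) by linarith
    then have "1 / r \<ge> 0" using p(1) by (simp add: r field_simps)
    then have "E \<le> 6 ^ m * c" unfolding E_def using sidon_const_ge[OF m p(1) r _ c] by blast
    \<comment> \<open>The base 1728 is dictated by the upper bound; 6 is enlarged to match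
      it.\<close>
    also have "\<dots> \<le> 1728 ^ m * c" using c(1) by (intro mult_right_mono power_mono) auto
    finally show "1 / 1728 ^ m * E \<le> c" by (simp add: field_simps)
  qed
qed simp

end
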